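(* Let $(\mathbb{X},\mathbb{R}^d)$ be a non-periodic topological tiling dynamical system with pure-point spectrum generated by a primitive inflation rule, with transversal $\mathbb{X}_0$. Then $\mathrm{OSD}(\mathbb{X},\mathbb{R}^d)$ can be computed from $\mathbb{X}_0$ as $$\mathrm{OSD}(\mathbb{X},\mathbb{R}^d)=\sup_{\delta>0}\,\limsup_{\nu\searrow0}\frac{\log\bigl(\mathrm{Sep}(\mathbb{X}_0,\delta,\nu)\bigr)}{-\log(\nu)}.$$
   Context: **Tilings.** A tile is a compact subset of $\mathbb{R}^d$ that is the closure of its interior, has boundary of Lebesgue measure $0$, and carries a type label; tiles of the same type are translates of each other and there are finitely many types. A tiling is a covering of $\mathbb{R}^d$ by tiles that overlap at most on their boundaries. For a tiling $x$, $x\sqcap B_r(a)$ is the set of tiles of $x$ meeting the closed ball $B_r(a)$; finite local complexity (FLC) means that, for each $r$, there are finitely many such patches up to translation. The tiling metric is $d(x_1,x_2)=\min\{\widetilde d(x_1,x_2),2^{-1/2}\}$ with $\widetilde d(x_1,x_2)=\inf\{\varepsilon>0:\exists\,t_1,t_2\in B_\varepsilon(0)\text{ with }(x_1-t_1)\sqcap B_{1/\varepsilon}(0)=(x_2-t_2)\sqcap B_{1/\varepsilon}(0)\}$. **Inflation.** A (stone) inflation $\varrho$ with factor $\lambda>1$ scales a tile, patch or tiling by $\lambda$ (about the origin) and dissects each scaled tile into tiles of the original sizes, in a way depending only on the tile type. It is primitive if some power of $\varrho$ maps every tile to a patch containing tiles of all types. $\mathbb{X}$ is the space of all tilings generated by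 $\varrho$ (a compact, strictly ergodic $\mathbb{R}^d$-system under translation). Standing assumptions: the tilings are FLC and non-periodic ($x+t=x$ only for $t=0$), and the translation action has pure-point dynamical spectrum with respect to the unique invariant probability measure. **Control points and transversal.** A return vector is a $t\in\mathbb{R}^d$ such that tiles $\tau$ and $\tau+t$ of the same type occur in one tiling of $\mathbb{X}$; $R$ is the $\mathbb{Z}$-span of all return vectors and $R_{\mathrm{ev}}=\bigcup_{n\ge0}\lambda^{-n}R$. Each tile $\tau$ is given a control point $\mathrm{cp}(\tau)$ with $\mathrm{cp}(\tau+t)=\mathrm{cp}(\tau)+t$, chosen such that differences of control points within a tiling lie in $R_{\mathrm{ev}}$, $\lambda\,\mathrm{cp}(\tau)$ is the control point of one of the tiles in the inflated tile $\varrho(\tau)$, and distinct tiles of a tiling have distinct control points. $\mathrm{cp}(x)$ is the set of control points of $x$, and $\mathbb{X}_0=\{x\in\mathbb{X}:0\in\mathrm{cp}(x)\}$. **OSD and separation numbers.** Fix a Følner sequence $\mathcal F=\{F_n\}$ in $\mathbb{R}^d$ (the choice is immaterial); $|\cdot|$ is Lebesgue measure. For $\delta>0$, $D_\delta(x,y)=\limsup_n|\{t:d(x+t,y+t)\ge\delta\}\cap F_n|/|F_n|$. A set $S\subseteq\mathbb{X}$ is $(\delta,\nu)$-separated if $D_\delta(x,y)\ge\nu$ for all distinct $x,y\in S$; $\mathrm{Sep}(\mathbb{X},\delta,\nu)$ (respectively $\mathrm{Sep}(\mathbb{X}_0,\delta,\nu)$) is the maximal cardinality of a $(\delta,\nu)$-separated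 subset of $\mathbb{X}$ (respectively of $\mathbb{X}_0$). $\mathrm{OSD}(\mathbb{X},\mathbb{R}^d)=\sup_{\delta>0}\limsup_{\nu\searrow0}\frac{\log\mathrm{Sep}(\mathbb{X},\delta,\nu)}{-\log\nu}$. *)

theory Defs
  imports "HOL-Probability.Probability"
begin

section \<open>Tilings\<close>

text \<open>
  A tile is a pair of its support and its type label. The finite label type \<open>'l\<close> is the set of
  tile types; the support of a tile of type \<open>l\<close> is a translate of the prototile \<open>proto l\<close>.
\<close>

type_synonym ('a, 'l) tile = "'a set \<times> 'l"
type_synonym ('a, 'l) pattern = "('a, 'l) tile set"

definition prototiles :: "('l::finite \<Rightarrow> 'a::euclidean_space set) \<Rightarrow> bool" where
  "prototiles proto \<longleftrightarrow>
     (\<forall>l. proto l \<noteq> {} \<and> compact (proto l) \<and> closure (interior (proto l)) = proto l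
        \<and> negligible (frontier (proto l)))"

definition is_tile :: "('l::finite \<Rightarrow> 'a::euclidean_space set) \<Rightarrow> ('a, 'l) tile \<Rightarrow> bool" where
  "is_tile proto T \<longleftrightarrow> (\<exists>t. fst T = (\<lambda>v. v + t) ` proto (snd T))"

definition shift_tile :: "'a::euclidean_space \<Rightarrow> ('a, 'l) tile \<Rightarrow> ('a, 'l) tile" where
  "shift_tile t T = ((\<lambda>v. v + t) ` fst T, snd T)"

text \<open>\<open>shift_pattern t x\<close> is the pattern \<open>x + t\<close>.\<close>

definition shift_pattern :: "'a::euclidean_space \<Rightarrow> ('a, 'l) pattern \<Rightarrow> ('a, 'l) pattern" where
  "shift_pattern t x = shift_tile t ` x"

definition packing :: "('l::finite \<Rightarrow> 'a::euclidean_space set) \<Rightarrow> ('a, 'l) pattern \<Rightarrow> bool" where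
  "packing proto x \<longleftrightarrow> (\<forall>T\<in>x. is_tile proto T) \<and>
     (\<forall>T\<in>x. \<forall>T'\<in>x. T \<noteq> T' \<longrightarrow> fst T \<inter> fst T' \<subseteq> frontier (fst T) \<inter> frontier (fst T'))"

definition tiling :: "('l::finite \<Rightarrow> 'a::euclidean_space set) \<Rightarrow> ('a, 'l) pattern \<Rightarrow> bool" where
  "tiling proto x \<longleftrightarrow> packing proto x \<and> (\<Union>T\<in>x. fst T) = UNIV"

definition patch :: "('a::euclidean_space, 'l) pattern \<Rightarrow> real \<Rightarrow> 'a \<Rightarrow> ('a, 'l) pattern" where
  "patch x r a = {T \<in> x. fst T \<inter> cball a r \<noteq> {}}"

definition flc :: "('a::euclidean_space, 'l) pattern \<Rightarrow> bool" where
  "flc x \<longleftrightarrow> (\<forall>r>0. \<exists>P. finite P \<and> (\<forall>a. \<exists>p\<in>P. \<exists>t. patch x r a = shift_pattern t p))"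

text \<open>The infimum is taken in \<^typ>\<open>ereal\<close> so that the infimum of the empty set is \<open>\<infinity>\<close>.\<close>

definition tiling_dist_aux :: "('a::euclidean_space, 'l) pattern \<Rightarrow> ('a, 'l) pattern \<Rightarrow> ereal" where
  "tiling_dist_aux x y = (INF \<epsilon>\<in>{\<epsilon>. \<epsilon> > 0 \<and>
     (\<exists>s\<in>cball 0 \<epsilon>. \<exists>t\<in>cball 0 \<epsilon>. patch (shift_pattern (- s) x) (1 / \<epsilon>) 0 = patch (shift_pattern (- t) y) (1 / \<epsilon>) 0)}.
     ereal \<epsilon>)"

definition tiling_dist :: "('a::euclidean_space, 'l) pattern \<Rightarrow> ('a, 'l) pattern \<Rightarrow> real" where
  "tiling_dist x y = real_of_ereal (min (tiling_dist_aux x y) (ereal (2 powr (- 1 / 2))))"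


section \<open>Inflations\<close>

text \<open>
  \<open>rho T\<close> is the dissection, into tiles, of the tile \<open>T\<close> scaled by \<open>lam\<close> about the origin. It depends
  only on the type of \<open>T\<close>, up to the translation that follows from the position of \<open>T\<close>.
\<close>

definition inflation ::
  "('l::finite \<Rightarrow> 'a::euclidean_space set) \<Rightarrow> real \<Rightarrow> (('a, 'l) tile \<Rightarrow> ('a, 'l) pattern) \<Rightarrow> bool" where
  "inflation proto lam rho \<longleftrightarrow> lam > 1 \<and>
     (\<forall>T. is_tile proto T \<longrightarrow>
        finite (rho T) \<and> packing proto (rho T) \<and> (\<Union>T'\<in>rho T. fst T') = (\<lambda>v. lam *\<^sub>R v) ` fst T \<and>
        (\<forall>t. rho (shift_tile t T) = shift_pattern (lam *\<^sub>R t) (rho T)))"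

definition inflate :: "(('a, 'l) tile \<Rightarrow> ('a, 'l) pattern) \<Rightarrow> ('a, 'l) pattern \<Rightarrow> ('a, 'l) pattern" where
  "inflate rho x = (\<Union>T\<in>x. rho T)"

definition primitive_inflation ::
  "('l::finite \<Rightarrow> 'a::euclidean_space set) \<Rightarrow> (('a, 'l) tile \<Rightarrow> ('a, 'l) pattern) \<Rightarrow> bool" where
  "primitive_inflation proto rho \<longleftrightarrow>
     (\<exists>n>0. \<forall>T. is_tile proto T \<longrightarrow> (\<forall>l. \<exists>T'\<in>(inflate rho ^^ n) {T}. snd T' = l))"

text \<open>
  The tilings generated by an inflation are those all of whose finite patches occur in iterated
  inflations of single tiles. Translates need not be mentioned, since \<open>T\<close> ranges over tiles in all
  positions.
\<close>

definition legal ::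
  "('l::finite \<Rightarrow> 'a::euclidean_space set) \<Rightarrow> (('a, 'l) tile \<Rightarrow> ('a, 'l) pattern) \<Rightarrow> ('a, 'l) pattern \<Rightarrow> bool" where
  "legal proto rho p \<longleftrightarrow> (\<exists>n T. is_tile proto T \<and> p \<subseteq> (inflate rho ^^ n) {T})"

definition tiling_space ::
  "('l::finite \<Rightarrow> 'a::euclidean_space set) \<Rightarrow> (('a, 'l) tile \<Rightarrow> ('a, 'l) pattern) \<Rightarrow> ('a, 'l) pattern set" where
  "tiling_space proto rho = {x. tiling proto x \<and> (\<forall>p\<subseteq>x. finite p \<longrightarrow> legal proto rho p)}"


section \<open>Pure-point dynamical spectrum\<close>

definition invariant_prob :: "('a::euclidean_space, 'l) pattern set \<Rightarrow> ('a, 'l) pattern measure \<Rightarrow> bool" where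
  "invariant_prob X \<mu> \<longleftrightarrow> prob_space \<mu> \<and> space \<mu> = X \<and>
     sets \<mu> = sigma_sets X {U. openin (Metric_space.mtopology X tiling_dist) U} \<and>
     (\<forall>t. distr \<mu> \<mu> (shift_pattern t) = \<mu>)"

definition square_integrable :: "'w measure \<Rightarrow> ('w \<Rightarrow> complex) \<Rightarrow> bool" where
  "square_integrable \<mu> f \<longleftrightarrow> f \<in> borel_measurable \<mu> \<and> integrable \<mu> (\<lambda>x. (cmod (f x))\<^sup>2)"

definition eigenfunction ::
  "('a::euclidean_space, 'l) pattern measure \<Rightarrow> (('a, 'l) pattern \<Rightarrow> complex) \<Rightarrow> bool" where
  "eigenfunction \<mu> f \<longleftrightarrow> square_integrable \<mu> f \<and> \<not> (AE x in \<mu>. f x = 0) \<and>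
     (\<exists>k. \<forall>t. AE x in \<mu>. f (shift_pattern t x) = cis (2 * pi * (k \<bullet> t)) * f x)"

text \<open>The linear span of the eigenfunctions is dense in \<open>L\<^sup>2(\<mu>)\<close>.\<close>

definition pure_point_spectrum :: "('a::euclidean_space, 'l) pattern measure \<Rightarrow> bool" where
  "pure_point_spectrum \<mu> \<longleftrightarrow>
     (\<forall>f \<epsilon>. square_integrable \<mu> f \<and> \<epsilon> > 0 \<longrightarrow>
        (\<exists>E c. finite E \<and> (\<forall>g\<in>E. eigenfunction \<mu> g) \<and>
           (\<integral>x. (cmod (f x - (\<Sum>g\<in>E. c g * g x)))\<^sup>2 \<partial>\<mu>) < \<epsilon>))"


section \<open>Control points\<close>

definition return_vectors :: "('a::euclidean_space, 'l) pattern set \<Rightarrow> 'a set" where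
  "return_vectors X = {t. \<exists>x\<in>X. \<exists>T\<in>x. shift_tile t T \<in> x}"

definition return_module :: "('a::euclidean_space, 'l) pattern set \<Rightarrow> 'a set" where
  "return_module X = module.span (\<lambda>m::int. \<lambda>v. of_int m *\<^sub>R v) (return_vectors X)"

definition return_module_ev :: "real \<Rightarrow> ('a::euclidean_space, 'l) pattern set \<Rightarrow> 'a set" where
  "return_module_ev lam X = (\<Union>n::nat. (\<lambda>v. inverse (lam ^ n) *\<^sub>R v) ` return_module X)"

definition control_points ::
  "('l::finite \<Rightarrow> 'a::euclidean_space set) \<Rightarrow> real \<Rightarrow> (('a, 'l) tile \<Rightarrow> ('a, 'l) pattern) \<Rightarrow>
   (('a, 'l) tile \<Rightarrow> 'a) \<Rightarrow> bool" where
  "control_points proto lam rho cp \<longleftrightarrow>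
     (\<forall>T t. is_tile proto T \<longrightarrow> cp (shift_tile t T) = cp T + t) \<and>
     (\<forall>x\<in>tiling_space proto rho. \<forall>T\<in>x. \<forall>T'\<in>x.
        cp T - cp T' \<in> return_module_ev lam (tiling_space proto rho)) \<and>
     (\<forall>T. is_tile proto T \<longrightarrow> (\<exists>T'\<in>rho T. cp T' = lam *\<^sub>R cp T)) \<and>
     (\<forall>x\<in>tiling_space proto rho. inj_on cp x)"

definition transversal ::
  "(('a::euclidean_space, 'l) tile \<Rightarrow> 'a) \<Rightarrow> ('a, 'l) pattern set \<Rightarrow> ('a, 'l) pattern set" where
  "transversal cp X = {x \<in> X. 0 \<in> cp ` x}"


section \<open>Orbit separation dimension\<close>

definition folner :: "(nat \<Rightarrow> 'a::euclidean_space set) \<Rightarrow> bool" where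
  "folner F \<longleftrightarrow> (\<forall>n. F n \<in> lmeasurable \<and> measure lebesgue (F n) > 0) \<and>
     (\<forall>t. (\<lambda>n. measure lebesgue (sym_diff ((\<lambda>v. v + t) ` F n) (F n)) / measure lebesgue (F n))
            \<longlonglongrightarrow> 0)"

definition sep_density ::
  "(nat \<Rightarrow> 'a::euclidean_space set) \<Rightarrow> real \<Rightarrow> ('a, 'l) pattern \<Rightarrow> ('a, 'l) pattern \<Rightarrow> ereal" where
  "sep_density F \<delta> x y = limsup (\<lambda>n. ereal
     (measure lebesgue ({t. tiling_dist (shift_pattern t x) (shift_pattern t y) \<ge> \<delta>} \<inter> F n) / measure lebesgue (F n)))"

definition separated ::
  "(nat \<Rightarrow> 'a::euclidean_space set) \<Rightarrow> real \<Rightarrow> real \<Rightarrow> ('a, 'l) pattern set \<Rightarrow> bool" where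
  "separated F \<delta> \<nu> S \<longleftrightarrow> (\<forall>x\<in>S. \<forall>y\<in>S. x \<noteq> y \<longrightarrow> sep_density F \<delta> x y \<ge> ereal \<nu>)"

definition ecard :: "'b set \<Rightarrow> enat" where
  "ecard S = (if finite S then enat (card S) else \<infinity>)"

definition Sep ::
  "(nat \<Rightarrow> 'a::euclidean_space set) \<Rightarrow> ('a, 'l) pattern set \<Rightarrow> real \<Rightarrow> real \<Rightarrow> enat" where
  "Sep F Y \<delta> \<nu> = (SUP S\<in>{S. S \<subseteq> Y \<and> separated F \<delta> \<nu> S}. ecard S)"

definition ln_enat :: "enat \<Rightarrow> ereal" where
  "ln_enat N = (case N of enat n \<Rightarrow> ereal (ln (real n)) | \<infinity> \<Rightarrow> \<infinity>)"

definition OSD :: "(nat \<Rightarrow> 'a::euclidean_space set) \<Rightarrow> ('a, 'l) pattern set \<Rightarrow> ereal" where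
  "OSD F X = (SUP \<delta>\<in>{0<..}. Limsup (at_right 0) (\<lambda>\<nu>. ln_enat (Sep F X \<delta> \<nu>) / ereal (- ln \<nu>)))"

end

theory Submission
  imports Defs "HOL-Real_Asymp.Real_Asymp"
begin

text \<open>
  A translation by a vector of norm at most \<open>r\<close> changes the tiling metric by at most \<open>r\<close>. Every tiling
  is \<open>y + v\<close> for some \<open>y\<close> in the transversal and some \<open>v\<close> in a fixed ball. Cover this ball by \<open>N\<close> balls
  of radius \<open>\<delta> / 2\<close>. Among the tilings whose \<open>v\<close> lies in the same small ball with centre \<open>c\<close>, the common
  translation by \<open>c\<close> does not affect densities along a Folner sequence and the remainder costs
  \<open>\<delta> / 2\<close>, so \<open>(\<delta>, \<nu>)\<close>-separation of the tilings gives \<open>(\<delta> / 2, \<nu>)\<close>-separation of their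
  representatives \<open>y\<close>. By the pigeonhole principle the two separation numbers differ by a factor of at most
  \<open>N\<close>, which is independent of \<open>\<nu>\<close> and therefore does not affect the logarithmic growth rate.
\<close>

section \<open>Translations and the tiling metric\<close>

lemma shift_tile_0 [simp]: "shift_tile 0 T = T"
  by (simp add: shift_tile_def)

lemma shift_tile_add: "shift_tile s (shift_tile t T) = shift_tile (s + t) T"
  by (simp add: shift_tile_def image_image add.assoc add.commute[of s])

lemma shift_pattern_0 [simp]: "shift_pattern 0 x = x"
  by (simp add: shift_pattern_def)

lemma shift_pattern_add: "shift_pattern s (shift_pattern t x) = shift_pattern (s + t) x"
  by (simp add: shift_pattern_def image_image shift_tile_add)

lemma patch_eq_antimono:
  assumes "patch x R a = patch y R a" "r \<le> R"
  shows "patch x r a = patch y r a"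
proof -
  have "patch z r a = {T \<in> patch z R a. fst T \<inter> cball a r \<noteq> {}}" for z :: "('a, 'b) pattern"
    using assms(2) by (fastforce simp: patch_def)
  then show ?thesis
    using assms(1) by simp
qed

lemma tiling_dist_aux_nonneg: "0 \<le> tiling_dist_aux x y"
  unfolding tiling_dist_aux_def by (intro INF_greatest) auto

text \<open>Witnesses \<open>s\<close>, \<open>t\<close> for \<open>e\<close> turn into witnesses
  \<open>s + u\<close>, \<open>t + w\<close> for \<open>e + r\<close>, and agreement on the ball of
  radius \<open>1 / e\<close> is inherited by the smaller ball of radius \<open>1 / (e + r)\<close>.
  The shifts \<open>u\<close> and \<open>w\<close> may differ, since two tilings will be moved to
  their representatives by different vectors.\<close>

lemma tiling_dist_aux_shift_le:
  assumes u: "norm u \<le> r" and w: "norm w \<le> r"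
  shows "tiling_dist_aux (shift_pattern u x) (shift_pattern w y) \<le> tiling_dist_aux x y + ereal r"
proof -
  \<comment> \<open>With \<open>r\<close> on the left, the infimum stands alone on the right and
    each admissible \<open>e\<close> can be treated separately.\<close>
  have "tiling_dist_aux (shift_pattern u x) (shift_pattern w y) - ereal r \<le> tiling_dist_aux x y"
    unfolding tiling_dist_aux_def[of x y]
  proof (rule INF_greatest, clarify)
    fix e :: real and s t
    assume e: "0 < e" and s: "s \<in> cball 0 e" and t: "t \<in> cball 0 e"
      and eq: "patch (shift_pattern (- s) x) (1 / e) 0 = patch (shift_pattern (- t) y) (1 / e) 0"
    have r: "0 \<le> r"
      using norm_ge_zero u by (rule order_trans)
    have "patch (shift_pattern (- s) x) (1 / (e + r)) 0 = patch (shift_pattern (- t) y) (1 / (e + r)) 0"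
      using e r by (intro patch_eq_antimono[OF eq]) (simp add: frac_le)
    then have "patch (shift_pattern (- (s + u)) (shift_pattern u x)) (1 / (e + r)) 0
        = patch (shift_pattern (- (t + w)) (shift_pattern w y)) (1 / (e + r)) 0"
      by (simp add: shift_pattern_add)
    moreover have "s + u \<in> cball 0 (e + r)" "t + w \<in> cball 0 (e + r)"
      using s t u w by (auto intro: norm_triangle_mono)
    ultimately have "tiling_dist_aux (shift_pattern u x) (shift_pattern w y) \<le> ereal (e + r)"
      unfolding tiling_dist_aux_def using e r by (intro INF_lower) (blast intro: add_pos_nonneg)
    then show "tiling_dist_aux (shift_pattern u x) (shift_pattern w y) - ereal r \<le> ereal e"
      by (simp add: ereal_minus_le)
  qed
  then show ?thesis
    by (simp add: ereal_minus_le)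
qed

text \<open>The cap and nonnegativity keep the minimum finite, so \<open>real_of_ereal\<close> never
  takes its default value.\<close>

lemma ereal_tiling_dist:
  "ereal (tiling_dist x y) = min (tiling_dist_aux x y) (ereal (2 powr (- 1 / 2)))"
  unfolding tiling_dist_def using tiling_dist_aux_nonneg[of x y]
  by (intro ereal_real') (auto simp: min_def)

lemma tiling_dist_shift_le:
  assumes u: "norm u \<le> r" and w: "norm w \<le> r"
  shows "tiling_dist (shift_pattern u x) (shift_pattern w y) \<le> tiling_dist x y + r"
proof -
  have "0 \<le> r"
    using norm_ge_zero u by (rule order_trans)
  have min_le: "min a c \<le> min b c + ereal r" if "a \<le> b + ereal r" for a b c :: ereal
  proof (cases "b \<le> c")
    case True
    then show ?thesis
      using min.coboundedI1[OF that] by (simp only: min_absorb1)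
  next
    case False
    have "c \<le> c + ereal r"
      using \<open>0 \<le> r\<close> by (intro add_increasing2) auto
    then show ?thesis
      using False min.coboundedI2[of c "c + ereal r" a] by (simp only: min_absorb2 linear not_le less_imp_le)
  qed
  have "ereal (tiling_dist (shift_pattern u x) (shift_pattern w y)) \<le> ereal (tiling_dist x y) + ereal r"
    unfolding ereal_tiling_dist by (rule min_le[OF tiling_dist_aux_shift_le[OF u w]])
  then show ?thesis
    by simp
qed

lemma tiling_dist_self [simp]: "tiling_dist x x = 0"
proof -
  have "tiling_dist_aux x x \<le> ereal e" if "e > 0" for e
    unfolding tiling_dist_aux_def
  proof (rule INF_lower, rule CollectI, intro conjI)
    show "\<exists>s\<in>cball 0 e. \<exists>t\<in>cball 0 e.
        patch (shift_pattern (- s) x) (1 / e) 0 = patch (shift_pattern (- t) x) (1 / e) 0"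
      using that by (intro bexI[of _ 0]) (simp_all only: mem_cball dist_self less_imp_le)
  qed fact
  then have "tiling_dist_aux x x \<le> 0"
    using ereal_le_epsilon2[of "tiling_dist_aux x x" 0] by simp
  then have "tiling_dist_aux x x = 0"
    using tiling_dist_aux_nonneg[of x x] by simp
  then show ?thesis
    by (simp add: tiling_dist_def min_def)
qed

text \<open>The function is 1-Lipschitz: passing from \<open>b\<close> to \<open>a\<close> shifts
  both tilings by \<open>a - b\<close>. Hence \<open>e\<close> itself serves as the modulus of
  continuity.\<close>

lemma continuous_on_tiling_dist_shift:
  "continuous_on UNIV (\<lambda>t. tiling_dist (shift_pattern t x) (shift_pattern t y))"
proof (rule continuous_on_iff[THEN iffD2], intro ballI allI impI exI conjI)
  fix t t' :: 'a and e :: real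
  assume e: "0 < e"
  show "0 < e" by fact
  assume t': "dist t' t < e"
  define h where "h = (\<lambda>t. tiling_dist (shift_pattern t x) (shift_pattern t y))"
  have "h a \<le> h b + dist a b" for a b
    using tiling_dist_shift_le[of "a - b" "dist a b" "a - b" "shift_pattern b x" "shift_pattern b y"]
    by (simp add: h_def shift_pattern_add dist_norm)
  from this[of t t'] this[of t' t] t' have "dist (h t') (h t) < e"
    by (simp add: dist_real_def dist_commute)
  then show "dist (tiling_dist (shift_pattern t' x) (shift_pattern t' y))
      (tiling_dist (shift_pattern t x) (shift_pattern t y)) < e"
    unfolding h_def .
qed

text \<open>Measurability matters here: \<open>measure\<close> is \<open>0\<close> on non-measurable sets, so without it
  \<open>sep_density\<close> would not be monotone.\<close>

lemma separation_set_measurable: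
  "{t. \<delta> \<le> tiling_dist (shift_pattern t x) (shift_pattern t y)} \<in> sets lebesgue"
proof -
  have "closed {t. \<delta> \<le> tiling_dist (shift_pattern t x) (shift_pattern t y)}"
    by (intro closed_Collect_le continuous_on_const continuous_on_tiling_dist_shift)
  then show ?thesis
    by (intro sets_completionI_sets) (simp only: sets_lborel borel_closed)
qed

section \<open>Separation densities and separation numbers\<close>

text \<open>Translation by \<open>c\<close> preserves the measure of \<open>A \<inter> F n\<close>
  and moves it into \<open>B\<close>. Points that leave \<open>F n\<close> lie in the symmetric
  difference of \<open>F n\<close> and its translate, whose relative volume vanishes by the Folner
  condition.\<close>

lemma limsup_density_translate_le:
  assumes F: "folner F" and A: "A \<in> sets lebesgue" and B: "B \<in> sets lebesgue"
    and AB: "\<And>t. t \<in> A \<Longrightarrow> t + c \<in> B"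
  shows "limsup (\<lambda>n. ereal (measure lebesgue (A \<inter> F n) / measure lebesgue (F n)))
    \<le> limsup (\<lambda>n. ereal (measure lebesgue (B \<inter> F n) / measure lebesgue (F n)))"
proof -
  let ?G = "\<lambda>n. (\<lambda>v. v + c) ` F n"
  let ?b = "\<lambda>n. measure lebesgue (sym_diff (?G n) (F n)) / measure lebesgue (F n)"
  have Fm: "F n \<in> lmeasurable" "measure lebesgue (F n) > 0" for n
    using F by (auto simp: folner_def)
  have Gm: "?G n \<in> lmeasurable" for n
    using measurable_translation[OF Fm(1), of c n] by (simp add: add.commute)
  have "measure lebesgue (A \<inter> F n) \<le> measure lebesgue (sym_diff (?G n) (F n)) + measure lebesgue (B \<inter> F n)" for n
  proof -
    have AF: "A \<inter> F n \<in> lmeasurable" and BF: "B \<inter> F n \<in> lmeasurable"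
      using A B Fm(1) by (metis fmeasurable_Int_fmeasurable Int_commute)+
    have D: "sym_diff (?G n) (F n) \<in> lmeasurable"
      using Gm Fm(1) by (simp add: fmeasurable.Diff fmeasurable.Un)
    have "measure lebesgue (A \<inter> F n) = measure lebesgue ((+) c ` (A \<inter> F n))"
      by (simp add: measure_translation)
    also have "\<dots> \<le> measure lebesgue (sym_diff (?G n) (F n) \<union> (B \<inter> F n))"
    proof (rule measure_mono_fmeasurable)
      show "(+) c ` (A \<inter> F n) \<subseteq> sym_diff (?G n) (F n) \<union> (B \<inter> F n)"
        using AB by (auto simp: add.commute)
      show "(+) c ` (A \<inter> F n) \<in> sets lebesgue"
        using measurable_translation[OF AF] by auto
      show "sym_diff (?G n) (F n) \<union> (B \<inter> F n) \<in> lmeasurable"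
        using D BF by (rule fmeasurable.Un)
    qed
    also have "\<dots> \<le> measure lebesgue (sym_diff (?G n) (F n)) + measure lebesgue (B \<inter> F n)"
      using D BF by (intro measure_Un_le) auto
    finally show ?thesis .
  qed
  then have "limsup (\<lambda>n. ereal (measure lebesgue (A \<inter> F n) / measure lebesgue (F n)))
    \<le> limsup (\<lambda>n. ereal (?b n) + ereal (measure lebesgue (B \<inter> F n) / measure lebesgue (F n)))"
    using Fm(2)
    by (intro Limsup_mono always_eventually) (auto simp: add_divide_distrib[symmetric] intro!: divide_right_mono)
  \<comment> \<open>The first summand converges, so the limsup of the sum splits with
    equality.\<close>
  also have "\<dots> = 0 + limsup (\<lambda>n. ereal (measure lebesgue (B \<inter> F n) / measure lebesgue (F n)))"
    using F by (intro ereal_limsup_lim_add) (auto simp: folner_def zero_ereal_def)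
  finally show ?thesis
    by simp
qed

lemma sep_density_shift_le:
  assumes F: "folner F" and u: "norm (u - c) \<le> \<epsilon>" and w: "norm (w - c) \<le> \<epsilon>"
  shows "sep_density F \<delta> (shift_pattern u x) (shift_pattern w y) \<le> sep_density F (\<delta> - \<epsilon>) x y"
  unfolding sep_density_def
proof (rule limsup_density_translate_le[OF F separation_set_measurable separation_set_measurable, where c = c])
  fix t
  assume "t \<in> {t. \<delta> \<le> tiling_dist (shift_pattern t (shift_pattern u x)) (shift_pattern t (shift_pattern w y))}"
  then show "t + c \<in> {t. \<delta> - \<epsilon> \<le> tiling_dist (shift_pattern t x) (shift_pattern t y)}"
    \<comment> \<open>Since \<open>t + u = (u - c) + (t + c)\<close>, and likewise for
      \<open>w\<close>, only the remainders \<open>u - c\<close> and \<open>w - c\<close> enter the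
      error \<open>\<epsilon>\<close>.\<close>
    using tiling_dist_shift_le[OF u w, of "shift_pattern (t + c) x" "shift_pattern (t + c) y"]
    by (simp add: shift_pattern_add algebra_simps)
qed

lemma sep_density_self:
  assumes "\<delta> > 0"
  shows "sep_density F \<delta> x x = 0"
  using assms by (simp add: sep_density_def Limsup_const flip: zero_ereal_def)

text \<open>Pigeonhole over the classes of \<open>k\<close>: inside one class, \<open>g\<close>
  preserves separation. It is also injective there, because two points with the same image would
  have density 0, below \<open>\<nu>\<close>.\<close>

lemma Sep_le_mult:
  assumes I: "finite I" "\<And>x. x \<in> Y \<Longrightarrow> k x \<in> I"
    and g: "\<And>x. x \<in> Y \<Longrightarrow> g x \<in> Z"
    and D: "\<And>x y. x \<in> Y \<Longrightarrow> y \<in> Y \<Longrightarrow> k x = k y \<Longrightarrow> sep_density F \<delta> x y \<le> sep_density F \<delta>' (g x) (g y)"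
    and \<delta>': "\<delta>' > 0" and \<nu>: "\<nu> > 0"
  shows "Sep F Y \<delta> \<nu> \<le> enat (card I) * Sep F Z \<delta>' \<nu>"
\<comment> \<open>In \<open>enat\<close>, \<open>0 * \<infinity> = 0\<close>, so an infinite
  separation number of \<open>Z\<close> gives a trivial bound only for nonempty
  \<open>I\<close>.\<close>
proof (cases "I = {}")
  case True
  then have "Y = {}"
    using I by auto
  then have "Sep F Y \<delta> \<nu> \<le> 0"
    unfolding Sep_def by (intro SUP_least) (auto simp: ecard_def zero_enat_def)
  then show ?thesis
    by simp
next
  case False
  show ?thesis
  proof (cases "Sep F Z \<delta>' \<nu>")
    case infinity
    then show ?thesis
      using False I(1) by (simp add: imult_is_infinity enat_0_iff)
  next
    case (enat m)
    have bound: "card S \<le> card I * m" if S: "finite S" "S \<subseteq> Y" "separated F \<delta> \<nu> S" for S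
    proof -
      have fib: "card {x \<in> S. k x = i} \<le> m" for i
      proof -
        let ?C = "{x \<in> S. k x = i}"
        have sep: "ereal \<nu> \<le> sep_density F \<delta>' (g x) (g y)" if "x \<in> ?C" "y \<in> ?C" "x \<noteq> y" for x y
        proof -
          have "ereal \<nu> \<le> sep_density F \<delta> x y"
            using S(3) that by (simp add: separated_def)
          also have "\<dots> \<le> sep_density F \<delta>' (g x) (g y)"
            using S(2) that by (intro D) auto
          finally show ?thesis .
        qed
        have inj: "inj_on g ?C"
        proof (rule inj_onI, rule ccontr)
          fix x y assume "x \<in> ?C" "y \<in> ?C" "g x = g y" "x \<noteq> y"
          then show False
            using sep[of x y] \<nu> sep_density_self[OF \<delta>', of F "g y"] by simp
        qed
        have "g ` ?C \<subseteq> Z"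
          using g S(2) by blast
        moreover have "separated F \<delta>' \<nu> (g ` ?C)"
          unfolding separated_def using sep by blast
        ultimately have "ecard (g ` ?C) \<le> Sep F Z \<delta>' \<nu>"
          unfolding Sep_def by (intro SUP_upper) auto
        then show ?thesis
          using inj S(1) enat by (simp add: ecard_def card_image)
      qed
      have "S = (\<Union>i\<in>I. {x \<in> S. k x = i})"
        using S I(2) by auto
      then have "card S = card (\<Union>i\<in>I. {x \<in> S. k x = i})"
        by (rule arg_cong)
      also have "\<dots> \<le> (\<Sum>i\<in>I. card {x \<in> S. k x = i})"
        by (rule card_UN_le[OF I(1)])
      also have "\<dots> \<le> card I * m"
        using fib by (intro sum_bounded_above[where K = m, simplified]) auto
      finally show ?thesis .
    qed
    have "ecard S \<le> enat (card I * m)" if S: "S \<subseteq> Y" "separated F \<delta> \<nu> S" for S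
    proof (cases "finite S")
      case True
      then show ?thesis
        using bound S by (simp add: ecard_def)
    next
      case False
      \<comment> \<open>An infinite separated set would contain a finite separated subset with one
        element more than the bound allows.\<close>
      then obtain T where T: "T \<subseteq> S" "finite T" "card T = Suc (card I * m)"
        using infinite_arbitrarily_large by blast
      then have "separated F \<delta> \<nu> T"
        using S(2) by (auto simp: separated_def)
      then show ?thesis
        using bound[OF T(2) order_trans[OF T(1) S(1)]] T(3) by simp
    qed
    then show ?thesis
      unfolding Sep_def[of F Y] enat times_enat_simps by (intro SUP_least) blast
  qed
qed

lemma Sep_mono: "Z \<subseteq> Y \<Longrightarrow> Sep F Z \<delta> \<nu> \<le> Sep F Y \<delta> \<nu>"
  unfolding Sep_def by (intro SUP_subset_mono) auto

lemma ln_enat_mono: "m \<le> n \<Longrightarrow> ln_enat m \<le> ln_enat n"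
proof (cases m; cases n)
  fix i j assume "m = enat i" "n = enat j" "m \<le> n"
  then show ?thesis
    by (cases "i = 0"; cases "j = 0") (auto simp: ln_enat_def)
qed (auto simp: ln_enat_def)

text \<open>Positive factors give equality. If a factor is 0, the left side is 0 by the convention
  \<open>ln 0 = 0\<close>, while the right side is nonnegative.\<close>

lemma ln_enat_mult_le: "ln_enat (enat N * m) \<le> ereal (ln (real N)) + ln_enat m"
proof (cases m)
  case (enat k)
  then show ?thesis
    by (cases "N = 0"; cases "k = 0") (auto simp: ln_enat_def ln_mult)
qed (auto simp: ln_enat_def)

text \<open>The factor \<open>N\<close> adds only the constant \<open>ln N\<close> to the numerator,
  and \<open>ln N / - ln \<nu>\<close> tends to 0.\<close>

lemma Limsup_ln_Sep_le:
  assumes le: "\<And>\<nu>. \<nu> > 0 \<Longrightarrow> a \<nu> \<le> enat N * b \<nu>"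
  shows "Limsup (at_right 0) (\<lambda>\<nu>. ln_enat (a \<nu>) / ereal (- ln \<nu>))
    \<le> Limsup (at_right 0) (\<lambda>\<nu>. ln_enat (b \<nu>) / ereal (- ln \<nu>))"
    (is "?A \<le> ?B")
proof (rule ereal_le_epsilon2)
  fix e :: real
  assume "e > 0"
  have "((\<lambda>\<nu>::real. ln (real N) / - ln \<nu>) \<longlongrightarrow> 0) (at_right 0)"
    by real_asymp
  then have "eventually (\<lambda>\<nu>. ln (real N) / - ln \<nu> < e) (at_right 0)"
    using \<open>e > 0\<close> by (rule order_tendstoD)
  \<comment> \<open>Below 1 the denominator \<open>- ln \<nu>\<close> is positive, so division by it
    preserves inequalities.\<close>
  moreover have "eventually (\<lambda>\<nu>::real. \<nu> \<in> {0<..<1}) (at_right 0)"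
    by (rule eventually_at_right_real) simp
  ultimately have "eventually (\<lambda>\<nu>. ln_enat (a \<nu>) / ereal (- ln \<nu>) \<le> ln_enat (b \<nu>) / ereal (- ln \<nu>) + ereal e) (at_right 0)"
  proof eventually_elim
    case (elim \<nu>)
    then have pos: "- ln \<nu> > 0"
      by simp
    have "ln_enat (a \<nu>) \<le> ereal (ln (real N)) + ln_enat (b \<nu>)"
      using elim by (intro order_trans[OF ln_enat_mono[OF le] ln_enat_mult_le]) simp
    then have "ln_enat (a \<nu>) / ereal (- ln \<nu>) \<le> (ereal (ln (real N)) + ln_enat (b \<nu>)) / ereal (- ln \<nu>)"
      using pos by (intro ereal_divide_right_mono) auto
    also have "\<dots> = ln_enat (b \<nu>) / ereal (- ln \<nu>) + ereal (ln (real N) / - ln \<nu>)"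
      using pos by (cases "b \<nu>") (auto simp: ln_enat_def add_divide_distrib)
    also have "\<dots> \<le> ln_enat (b \<nu>) / ereal (- ln \<nu>) + ereal e"
      using elim by (intro add_left_mono) simp
    finally show ?case .
  qed
  then have "?A \<le> Limsup (at_right 0) (\<lambda>\<nu>. ln_enat (b \<nu>) / ereal (- ln \<nu>) + ereal e)"
    by (rule Limsup_mono)
  also have "\<dots> = ?B + ereal e"
    by (intro Limsup_add_ereal_right) auto
  finally show "?A \<le> ?B + ereal e" .
qed

section \<open>The tiling space and its transversal\<close>

lemma is_tile_shift:
  assumes "is_tile proto T"
  shows "is_tile proto (shift_tile t T)"
proof -
  obtain s where "fst T = (\<lambda>v. v + s) ` proto (snd T)"
    using assms by (auto simp: is_tile_def)
  then show ?thesis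
    by (auto simp: is_tile_def shift_tile_def image_image add.assoc intro!: exI[of _ "s + t"])
qed

lemma packing_shift:
  assumes "packing proto x"
  shows "packing proto (shift_pattern t x)"
proof -
  have im: "(\<lambda>v. v + t) ` C = (+) t ` C" for C
    by (rule image_cong[OF refl add.commute])
  have inj: "inj (\<lambda>v. v + t)"
    by (rule injI) (rule add_right_imp_eq)
  have fr: "frontier ((\<lambda>v. v + t) ` C) = (\<lambda>v. v + t) ` frontier C" for C
    unfolding im by (rule frontier_translation)
  show ?thesis
    unfolding packing_def shift_pattern_def
  proof (intro conjI ballI impI; elim imageE; hypsubst)
    fix T assume "T \<in> x"
    then show "is_tile proto (shift_tile t T)"
      using assms is_tile_shift unfolding packing_def by blast
  next
    fix T T' assume T: "T \<in> x" "T' \<in> x" "shift_tile t T \<noteq> shift_tile t T'"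
    then have "T \<noteq> T'"
      by auto
    then have "fst T \<inter> fst T' \<subseteq> frontier (fst T) \<inter> frontier (fst T')"
      using assms T(1,2) unfolding packing_def by blast
    then have "(\<lambda>v. v + t) ` (fst T \<inter> fst T') \<subseteq> (\<lambda>v. v + t) ` (frontier (fst T) \<inter> frontier (fst T'))"
      by (rule image_mono)
    then show "fst (shift_tile t T) \<inter> fst (shift_tile t T') \<subseteq> frontier (fst (shift_tile t T)) \<inter> frontier (fst (shift_tile t T'))"
      by (simp only: shift_tile_def fst_conv fr image_Int[OF inj])
  qed
qed

lemma tiling_shift:
  assumes "tiling proto x"
  shows "tiling proto (shift_pattern t x)"
proof -
  have "(\<Union>T\<in>shift_pattern t x. fst T) = (\<lambda>v. v + t) ` (\<Union>T\<in>x. fst T)"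
    by (auto simp: shift_pattern_def shift_tile_def)
  also have "\<dots> = UNIV"
    using assms by (simp add: tiling_def surj_plus_right)
  finally show ?thesis
    using assms packing_shift by (auto simp: tiling_def)
qed

text \<open>\<open>inflation\<close> constrains \<open>rho\<close> on tiles only, so its shift rule
  can be iterated only once all intermediate patterns are known to consist of tiles.\<close>

lemma funpow_inflate_is_tile:
  assumes rho: "inflation proto lam rho" and T: "is_tile proto T" "T' \<in> (inflate rho ^^ n) {T}"
  shows "is_tile proto T'"
  using T(2)
proof (induction n arbitrary: T')
  case 0
  then show ?case
    using T(1) by simp
next
  case (Suc n)
  then obtain S where "S \<in> (inflate rho ^^ n) {T}" "T' \<in> rho S"
    by (force simp only: funpow.simps o_apply inflate_def[of rho "(inflate rho ^^ n) {T}"])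
  then show ?case
    using Suc.IH rho unfolding inflation_def packing_def by blast
qed

lemma funpow_inflate_shift:
  assumes rho: "inflation proto lam rho" and T: "is_tile proto T"
  shows "(inflate rho ^^ n) {shift_tile t T} = shift_pattern (lam ^ n *\<^sub>R t) ((inflate rho ^^ n) {T})"
proof (induction n)
  case 0
  then show ?case
    by (simp add: shift_pattern_def)
next
  case (Suc n)
  have "inflate rho (shift_pattern s p) = shift_pattern (lam *\<^sub>R s) (inflate rho p)"
    if "\<And>T. T \<in> p \<Longrightarrow> is_tile proto T" for s p
    using that rho by (fastforce simp: inflate_def inflation_def shift_pattern_def)
  then show ?case
    using Suc funpow_inflate_is_tile[OF rho T] by simp
qed

text \<open>Shifting the seed tile by \<open>t\<close> divided by \<open>lam ^ n\<close> shifts its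
  \<open>n\<close>-fold inflation by \<open>t\<close>.\<close>

lemma legal_shift:
  assumes rho: "inflation proto lam rho" and p: "legal proto rho p"
  shows "legal proto rho (shift_pattern t p)"
proof -
  obtain n T where T: "is_tile proto T" "p \<subseteq> (inflate rho ^^ n) {T}"
    using p by (auto simp: legal_def)
  have "lam > 1"
    using rho by (simp add: inflation_def)
  then have "(inflate rho ^^ n) {shift_tile (inverse (lam ^ n) *\<^sub>R t) T} = shift_pattern t ((inflate rho ^^ n) {T})"
    using funpow_inflate_shift[OF rho T(1)] by simp
  then have "shift_pattern t p \<subseteq> (inflate rho ^^ n) {shift_tile (inverse (lam ^ n) *\<^sub>R t) T}"
    using T(2) by (auto simp: shift_pattern_def)
  then show ?thesis
    unfolding legal_def using is_tile_shift[OF T(1)] by blast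
qed

lemma tiling_space_shift:
  assumes rho: "inflation proto lam rho" and x: "x \<in> tiling_space proto rho"
  shows "shift_pattern t x \<in> tiling_space proto rho"
proof -
  have "legal proto rho p" if "p \<subseteq> shift_pattern t x" "finite p" for p
  proof -
    have "shift_pattern (- t) p \<subseteq> shift_pattern (- t) (shift_pattern t x)"
      using that(1) by (auto simp: shift_pattern_def)
    then have "shift_pattern (- t) p \<subseteq> x"
      by (simp add: shift_pattern_add)
    moreover have "finite (shift_pattern (- t) p)"
      using that(2) by (simp add: shift_pattern_def)
    ultimately have "legal proto rho (shift_pattern (- t) p)"
      using x by (simp add: tiling_space_def)
    from legal_shift[OF rho this, of t] show ?thesis
      by (simp add: shift_pattern_add)
  qed
  then show ?thesis
    using x tiling_shift by (auto simp: tiling_space_def)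
qed

text \<open>A tile containing 0 is its prototile shifted by \<open>- v\<close> for some
  \<open>v\<close> in that prototile. Prototiles are bounded and there are finitely many types, so
  both the shift and the prototile's control point are bounded.\<close>

lemma control_point_bounded:
  assumes "prototiles proto" and cp: "\<And>T t. is_tile proto T \<Longrightarrow> cp (shift_tile t T) = cp T + t"
  obtains R where "\<And>T. is_tile proto T \<Longrightarrow> 0 \<in> fst T \<Longrightarrow> norm (cp T) \<le> R"
proof -
  let ?P = "\<Union>l. proto l" and ?c = "\<lambda>l. norm (cp (proto l, l))"
  have "bounded ?P"
    using assms(1) by (intro bounded_UN) (auto simp: prototiles_def compact_imp_bounded)
  then obtain M where M: "\<And>v. v \<in> ?P \<Longrightarrow> norm v \<le> M"
    by (auto simp: bounded_iff)
  show ?thesis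
  proof (rule that)
    fix T assume "is_tile proto T" "0 \<in> fst T"
    then obtain t v where t: "fst T = (\<lambda>v. v + t) ` proto (snd T)" and v: "v \<in> proto (snd T)" "0 = v + t"
      by (auto simp: is_tile_def)
    have "is_tile proto (proto (snd T), snd T)"
      by (auto simp: is_tile_def intro!: exI[of _ 0])
    moreover have "T = shift_tile t (proto (snd T), snd T)"
      using t by (simp add: shift_tile_def prod_eq_iff)
    ultimately have "cp T = cp (proto (snd T), snd T) + t"
      using cp by metis
    moreover have "t = - v"
      using v(2) by (metis add.commute add_eq_0_iff)
    moreover have "norm v \<le> M"
      using M v(1) by blast
    moreover have "?c (snd T) \<le> (\<Sum>l\<in>UNIV. ?c l)"
      by (rule member_le_sum) auto
    ultimately show "norm (cp T) \<le> (\<Sum>l\<in>UNIV. ?c l) + M"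
      by (metis norm_minus_cancel norm_triangle_mono)
  qed
qed

text \<open>Some tile covers the origin; moving its control point to 0 is a bounded shift into the
  transversal.\<close>

lemma tiling_space_shift_transversal:
  assumes "prototiles proto" "inflation proto lam rho" "control_points proto lam rho cp"
  obtains R where "\<And>x. x \<in> tiling_space proto rho \<Longrightarrow>
    \<exists>v\<in>cball 0 R. shift_pattern (- v) x \<in> transversal cp (tiling_space proto rho)"
proof -
  have cp: "cp (shift_tile t T) = cp T + t" if "is_tile proto T" for T t
    using assms(3) that unfolding control_points_def by blast
  obtain R where R: "\<And>T. is_tile proto T \<Longrightarrow> 0 \<in> fst T \<Longrightarrow> norm (cp T) \<le> R"
    using control_point_bounded[OF assms(1), of cp] cp by blast
  show ?thesis
  proof (rule that)
    fix x assume x: "x \<in> tiling_space proto rho"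
    then have "0 \<in> (\<Union>T\<in>x. fst T)" "packing proto x"
      by (simp_all add: tiling_space_def tiling_def)
    then obtain T where T: "T \<in> x" "0 \<in> fst T" "is_tile proto T"
      by (auto simp: packing_def)
    have "cp (shift_tile (- cp T) T) = 0"
      using cp[OF T(3)] by simp
    then have "0 \<in> cp ` shift_pattern (- cp T) x"
      using T(1) unfolding shift_pattern_def by (metis image_eqI)
    then show "\<exists>v\<in>cball 0 R. shift_pattern (- v) x \<in> transversal cp (tiling_space proto rho)"
      using R[OF T(3,2)] tiling_space_shift[OF assms(2) x]
      by (intro bexI[of _ "cp T"]) (auto simp: transversal_def)
  qed
qed

text \<open>\<open>N\<close> is the number of balls of radius \<open>\<delta> / 2\<close> in a cover
  of \<open>cball 0 R\<close>. It is fixed before \<open>\<nu>\<close>, as the limit in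
  \<open>\<nu>\<close> requires.\<close>

lemma Sep_le_Sep_of_bounded_shifts:
  assumes F: "folner F" and Y: "\<And>x. x \<in> Y \<Longrightarrow> \<exists>v\<in>cball 0 R. shift_pattern (- v) x \<in> Z"
    and \<delta>: "\<delta> > 0"
  obtains N where "\<And>\<nu>. \<nu> > 0 \<Longrightarrow> Sep F Y \<delta> \<nu> \<le> enat N * Sep F Z (\<delta> / 2) \<nu>"
proof -
  have "\<exists>v. \<forall>x\<in>Y. v x \<in> cball 0 R \<and> shift_pattern (- v x) x \<in> Z"
    by (rule bchoice) (use Y in blast)
  then obtain v where v: "\<And>x. x \<in> Y \<Longrightarrow> v x \<in> cball 0 R" "\<And>x. x \<in> Y \<Longrightarrow> shift_pattern (- v x) x \<in> Z"
    by blast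
  have "\<forall>\<epsilon>>0. \<exists>I. finite I \<and> cball (0 :: 'a) R \<subseteq> (\<Union>c\<in>I. ball c \<epsilon>)"
    using compact_cball[of "0 :: 'a" R] unfolding compact_eq_totally_bounded by (rule conjunct2)
  from this[rule_format, OF half_gt_zero[OF \<delta>]]
  obtain I where "finite I \<and> cball (0 :: 'a) R \<subseteq> (\<Union>c\<in>I. ball c (\<delta> / 2))" ..
  then have I: "finite I" "cball 0 R \<subseteq> (\<Union>c\<in>I. ball c (\<delta> / 2))"
    by simp_all
  have "\<exists>c\<in>I. norm (v x - c) \<le> \<delta> / 2" if x: "x \<in> Y" for x
  proof -
    obtain c where "c \<in> I" "v x \<in> ball c (\<delta> / 2)"
      using v(1)[OF x] I(2) by blast
    then show ?thesis
      by (intro bexI[of _ c]) (simp_all add: dist_norm norm_minus_commute)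
  qed
  then have "\<exists>k. \<forall>x\<in>Y. k x \<in> I \<and> norm (v x - k x) \<le> \<delta> / 2"
    by (intro bchoice) blast
  then obtain k where k: "\<And>x. x \<in> Y \<Longrightarrow> k x \<in> I" "\<And>x. x \<in> Y \<Longrightarrow> norm (v x - k x) \<le> \<delta> / 2"
    by blast
  show ?thesis
  proof (rule that)
    fix \<nu> :: real
    assume \<nu>: "\<nu> > 0"
    show "Sep F Y \<delta> \<nu> \<le> enat (card I) * Sep F Z (\<delta> / 2) \<nu>"
    proof (rule Sep_le_mult[OF I(1) k(1) v(2) _ half_gt_zero[OF \<delta>] \<nu>])
      fix x y assume xy: "x \<in> Y" "y \<in> Y" "k x = k y"
      have "norm (v y - k x) \<le> \<delta> / 2"
        unfolding xy(3) by (rule k(2)[OF xy(2)])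
      \<comment> \<open>Each tiling is its representative shifted back by \<open>v x\<close> or
        \<open>v y\<close>, and both vectors are within \<open>\<delta> / 2\<close> of the common
        centre \<open>k x\<close>.\<close>
      from sep_density_shift_le[OF F k(2)[OF xy(1)] this,
          of \<delta> "shift_pattern (- v x) x" "shift_pattern (- v y) y"]
      show "sep_density F \<delta> x y \<le> sep_density F (\<delta> / 2) (shift_pattern (- v x) x) (shift_pattern (- v y) y)"
        by (simp add: shift_pattern_add)
    qed
  qed
qed

theorem corollary3p9:
  fixes proto :: "'l::finite \<Rightarrow> 'a::euclidean_space set"
    and lam :: real
    and rho :: "('a, 'l) tile \<Rightarrow> ('a, 'l) pattern"
    and cp :: "('a, 'l) tile \<Rightarrow> 'a"
    and \<mu> :: "('a, 'l) pattern measure"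
    and F :: "nat \<Rightarrow> 'a set"
    and X :: "('a, 'l) pattern set"
  assumes "prototiles proto"
    and "inflation proto lam rho"
    and "primitive_inflation proto rho"
    and X: "X = tiling_space proto rho"
    and "\<And>x. x \<in> X \<Longrightarrow> flc x"
    and "\<And>x t. x \<in> X \<Longrightarrow> shift_pattern t x = x \<Longrightarrow> t = 0"
    and "invariant_prob X \<mu>"
    and "pure_point_spectrum \<mu>"
    and "control_points proto lam rho cp"
    and "folner F"
  shows "OSD F X =
    (SUP \<delta>\<in>{0<..}. Limsup (at_right 0)
       (\<lambda>\<nu>. ln_enat (Sep F (transversal cp X) \<delta> \<nu>) / ereal (- ln \<nu>)))"
proof -
  let ?L = "\<lambda>Y \<delta>. Limsup (at_right 0) (\<lambda>\<nu>. ln_enat (Sep F Y \<delta> \<nu>) / ereal (- ln \<nu>))"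
  let ?X0 = "transversal cp X"
  obtain R where R: "\<And>x. x \<in> X \<Longrightarrow> \<exists>v\<in>cball 0 R. shift_pattern (- v) x \<in> ?X0"
    using tiling_space_shift_transversal[OF assms(1,2,9)] unfolding X by blast
  \<comment> \<open>Halving \<open>\<delta>\<close> is harmless because the supremum runs over all
    positive values.\<close>
  have le: "?L X \<delta> \<le> ?L ?X0 (\<delta> / 2)" if \<delta>: "\<delta> > 0" for \<delta>
  proof -
    obtain N where "\<And>\<nu>. \<nu> > 0 \<Longrightarrow> Sep F X \<delta> \<nu> \<le> enat N * Sep F ?X0 (\<delta> / 2) \<nu>"
      using Sep_le_Sep_of_bounded_shifts[OF \<open>folner F\<close> R \<delta>] by blast
    then show ?thesis
      by (rule Limsup_ln_Sep_le)
  qed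
  \<comment> \<open>The transversal is a subset of \<open>X\<close>, so the growth comparison
    applies with factor 1.\<close>
  have ge: "?L ?X0 \<delta> \<le> ?L X \<delta>" for \<delta>
  proof (rule Limsup_ln_Sep_le)
    fix \<nu> :: real
    show "Sep F ?X0 \<delta> \<nu> \<le> enat 1 * Sep F X \<delta> \<nu>"
      unfolding one_enat_def[symmetric] mult_1_left by (rule Sep_mono) (auto simp: transversal_def)
  qed
  show ?thesis
    unfolding OSD_def
  proof (rule antisym; rule SUP_mono)
    show "\<exists>\<delta>'\<in>{0<..}. ?L X \<delta> \<le> ?L ?X0 \<delta>'" if "\<delta> \<in> {0<..}" for \<delta>
      using le[of \<delta>] that by (intro bexI[of _ "\<delta> / 2"]) auto
    show "\<exists>\<delta>'\<in>{0<..}. ?L ?X0 \<delta> \<le> ?L X \<delta>'" if "\<delta> \<in> {0<..}" for \<delta>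
      using ge[of \<delta>] that by blast
  qed
qed

end
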